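(* Let $N\ge0$ be an integer, $R=abcdef$, and for $\mu\in\{0,1,2\}$ let $S^3_{3N+\mu}(a,b,c,d,e,f)=\sum_{\pi\in\mathcal{S}^3_{3N+\mu,\infty}}\omega^3_\pi(a,b,c,d,e,f)$ and $DS^3_{3N+\mu}(a,b,c,d,e,f)=\sum_{\pi\in\mathcal{DS}^3_{3N+\mu,\infty}}\omega^3_\pi(a,b,c,d,e,f)$. For $T=(t_1,t_2,t_3,t_4)\in\mathbb{N}^4$ put $$F(T)=\frac{(a+ab)^{t_1}(abcd+abcde)^{t_2}(abc)^{t_3}}{(R;R)_{t_1}(R;R)_{t_2}(R;R)_{t_3}(R;R)_{t_4}}.$$ Then, with all sums over $T\in\mathbb{N}^4$ with $t_1+t_2+t_3+t_4=N$, $$S^3_{3N}=\sum_T R^{\binom{t_1}{2}+\binom{t_2}{2}}F(T),\qquad S^3_{3N+2}=(1+a+ab)\sum_T R^{\binom{t_1+1}{2}+\binom{t_2}{2}}F(T),$$ $$S^3_{3N+1}(a,b,c,d,e,f)=S^3_{3N}(a,b,c,d,e,f)+a(abc)^N S^3_{3N}(d,e,f,a,b,c),$$ and $DS^3_{3N+\mu}=(R;R)_N\,S^3_{3N+\mu}$ for $\mu\in\{0,1,2\}$.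
   Context: $\mathcal{S}^3$ is the set of 3-strict partitions: partitions in which for no $l\ge0$ do $3l+1$ and $3l+2$ both appear, and no part $\not\equiv0\pmod3$ is repeated. $\mathcal{DS}^3$ is the set of 3-strict partitions into distinct parts. $\mathcal{F}_{N,\infty}$ denotes the subset of $\mathcal{F}$ of partitions with largest part $\le N$ (empty partition included). The weight $\omega^3_\pi(a,b,c,d,e,f)$ is the product of labels when cells of each odd-indexed row of the Ferrers diagram of $\pi$ (top row indexed 1) are labelled left to right cyclically $a,b,c$ and cells of each even-indexed row cyclically $d,e,f$. $(x;q)_n=\prod_{i=1}^n(1-xq^{i-1})$, $(x;q)_0=1$. *)

theory Defs
  imports "HOL-Analysis.Analysis"
begin

text \<open>
  A partition is the weakly decreasing list of its positive parts, so that the list entry at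
  position i (counted from 0) is the length of row i + 1 of the Ferrers diagram.
\<close>

definition partitions :: "nat list set" where
  "partitions = {p. sorted_wrt (\<ge>) p \<and> (\<forall>x\<in>set p. 0 < x)}"

definition strict3 :: "nat list set" where
  "strict3 = {p \<in> partitions.
     (\<forall>l. \<not> (3 * l + 1 \<in> set p \<and> 3 * l + 2 \<in> set p)) \<and>
     (\<forall>x\<in>set p. \<not> 3 dvd x \<longrightarrow> count_list p x = 1)}"

definition dstrict3 :: "nat list set" where
  "dstrict3 = {p \<in> strict3. distinct p}"

definition parts_le :: "nat list set \<Rightarrow> nat \<Rightarrow> nat list set" where
  "parts_le A n = {p \<in> A. \<forall>x\<in>set p. x \<le> n}"

text \<open>Rows and columns are counted from 0 here, so the first, third, ... rows have even index.\<close>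

definition cell_label ::
  "complex \<Rightarrow> complex \<Rightarrow> complex \<Rightarrow> complex \<Rightarrow> complex \<Rightarrow> complex \<Rightarrow> nat \<Rightarrow> nat \<Rightarrow> complex" where
  "cell_label a b c d e f i j = (if even i then [a, b, c] ! (j mod 3) else [d, e, f] ! (j mod 3))"

definition weight3 ::
  "complex \<Rightarrow> complex \<Rightarrow> complex \<Rightarrow> complex \<Rightarrow> complex \<Rightarrow> complex \<Rightarrow> nat list \<Rightarrow> complex" where
  "weight3 a b c d e f p = (\<Prod>i<length p. \<Prod>j<p ! i. cell_label a b c d e f i j)"

text \<open>
  The weighted generating functions are unordered sums of complex numbers. As parts divisible by 3
  may be repeated, the first one is in general an infinite sum.
\<close>

definition S3 ::
  "nat \<Rightarrow> complex \<Rightarrow> complex \<Rightarrow> complex \<Rightarrow> complex \<Rightarrow> complex \<Rightarrow> complex \<Rightarrow> complex" where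
  "S3 n a b c d e f = (\<Sum>\<^sub>\<infinity>p\<in>parts_le strict3 n. weight3 a b c d e f p)"

definition DS3 ::
  "nat \<Rightarrow> complex \<Rightarrow> complex \<Rightarrow> complex \<Rightarrow> complex \<Rightarrow> complex \<Rightarrow> complex \<Rightarrow> complex" where
  "DS3 n a b c d e f = (\<Sum>\<^sub>\<infinity>p\<in>parts_le dstrict3 n. weight3 a b c d e f p)"

definition qpoch :: "complex \<Rightarrow> complex \<Rightarrow> nat \<Rightarrow> complex" where
  "qpoch x q n = (\<Prod>i=1..n. 1 - x * q ^ (i - 1))"

definition quads :: "nat \<Rightarrow> (nat \<times> nat \<times> nat \<times> nat) set" where
  "quads N = {(t1, t2, t3, t4). t1 + t2 + t3 + t4 = N}"

lemma finite_quads: "finite (quads N)"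
  by (rule finite_subset[of _ "{..N} \<times> {..N} \<times> {..N} \<times> {..N}"]) (auto simp: quads_def)

definition F_term ::
  "complex \<Rightarrow> complex \<Rightarrow> complex \<Rightarrow> complex \<Rightarrow> complex \<Rightarrow> complex \<Rightarrow>
   nat \<Rightarrow> nat \<Rightarrow> nat \<Rightarrow> nat \<Rightarrow> complex" where
  "F_term a b c d e f t1 t2 t3 t4 =
     (let R = a * b * c * d * e * f in
       (a + a * b) ^ t1 * (a * b * c * d + a * b * c * d * e) ^ t2 * (a * b * c) ^ t3 /
       (qpoch R R t1 * qpoch R R t2 * qpoch R R t3 * qpoch R R t4))"

end

theory Submission
  imports Defs "HOL-Computational_Algebra.Formal_Power_Series"
begin

unbundle no vec_syntax and fps_syntax

text \<open>
  Removing the top row exchanges \<open>(a,b,c)\<close> with \<open>(d,e,f)\<close>, so that, with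
  \<open>z = abc\<close>, \<open>x = a + ab\<close>, \<open>y = d + de\<close> and a prime for this exchange,
  \<open>S(3N+2) = S(3N) + x z^N S'(3N)\<close> and \<open>S(3N+3) = S(3N+2) + z^(N+1) S'(3N+3)\<close>;
  for distinct parts the last term is \<open>z^(N+1) DS'(3N+2)\<close>. Together these give
  \<open>(1 - R^(N+1)) S(3N+3) = (1 + zyR^N) S(3N) + (x + z) z^N S'(3N)\<close>.
  With \<open>u = zy\<close>, the claimed values of \<open>S(3N)\<close> are the coefficients of
  \<open>G(T) = (-xT;R) (-uT;R) / ((zT;R) (T;R))\<close> (infinite products), and those of \<open>z^N S'(3N)\<close>
  are the coefficients of \<open>(-xRT;R) (-uT;R) / ((zT;R) (RT;R))\<close>. Dividing by
  \<open>(-xRT;R) (-uRT;R) / ((zT;R) (T;R))\<close> turns the recurrence into a polynomial identity.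
\<close>

section \<open>Removing the largest part\<close>

text \<open>As \<open>v\<close> bounds all parts, only \<open>v\<close> itself can create a new
  conflict: a repetition when 3 does not divide \<open>v\<close>, or its partner in the pair 3l+1,
  3l+2. For \<open>v = 3l+1\<close> the partner is too large to occur; for \<open>v = 3l+2\<close>
  it is \<open>v - 1\<close>.\<close>

lemma parts_le_strict3_Cons:
  "v # p \<in> parts_le strict3 v \<longleftrightarrow>
     0 < v \<and> p \<in> parts_le strict3 v \<and>
     (v mod 3 = 1 \<longrightarrow> v \<notin> set p) \<and> (v mod 3 = 2 \<longrightarrow> v \<notin> set p \<and> v - 1 \<notin> set p)"
proof
  assume l: "v # p \<in> parts_le strict3 v"
  have cnt: "\<And>x. x \<in> set (v # p) \<Longrightarrow> \<not> 3 dvd x \<Longrightarrow> count_list (v # p) x = 1"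
    and lm: "\<And>l. \<not> (3 * l + 1 \<in> set (v # p) \<and> 3 * l + 2 \<in> set (v # p))"
    using l by (auto simp: parts_le_def strict3_def)
  have "count_list p x = 1" if "x \<in> set p" "\<not> 3 dvd x" for x
    using cnt[of x] that count_list_0_iff[of p x] by (auto split: if_splits)
  moreover have "v \<notin> set p" if "\<not> 3 dvd v"
    using cnt[of v] that count_list_0_iff[of p v] by auto
  moreover have "v - 1 \<notin> set p" if "v mod 3 = 2"
  proof -
    have "v = 3 * (v div 3) + 2" "v - 1 = 3 * (v div 3) + 1" using that by presburger+
    thus ?thesis using lm[of "v div 3"] by (metis list.set_intros)
  qed
  moreover have "0 < v" "sorted_wrt (\<ge>) p" "\<forall>x\<in>set p. 0 < x" "\<forall>x\<in>set p. x \<le> v"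
    using l by (auto simp: parts_le_def strict3_def partitions_def)
  moreover have "\<not> 3 dvd v" if "v mod 3 = 1 \<or> v mod 3 = 2"
    using that by (auto simp: dvd_eq_mod_eq_0)
  ultimately show "0 < v \<and> p \<in> parts_le strict3 v \<and>
     (v mod 3 = 1 \<longrightarrow> v \<notin> set p) \<and> (v mod 3 = 2 \<longrightarrow> v \<notin> set p \<and> v - 1 \<notin> set p)"
    using lm unfolding parts_le_def strict3_def partitions_def mem_Collect_eq by (meson list.set_intros)
next
  assume r: "0 < v \<and> p \<in> parts_le strict3 v \<and>
     (v mod 3 = 1 \<longrightarrow> v \<notin> set p) \<and> (v mod 3 = 2 \<longrightarrow> v \<notin> set p \<and> v - 1 \<notin> set p)"
  have "\<not> (3 * l + 1 \<in> set (v # p) \<and> 3 * l + 2 \<in> set (v # p))" for l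
  proof
    assume h: "3 * l + 1 \<in> set (v # p) \<and> 3 * l + 2 \<in> set (v # p)"
    have p: "\<not> (3 * l + 1 \<in> set p \<and> 3 * l + 2 \<in> set p)" "\<forall>x\<in>set p. x \<le> v"
      using r by (auto simp: parts_le_def strict3_def)
    have "v = 3 * l + 1 \<and> 3 * l + 2 \<in> set p \<or> v = 3 * l + 2 \<and> 3 * l + 1 \<in> set p"
      using h p(1) by auto
    thus False
    proof
      assume "v = 3 * l + 1 \<and> 3 * l + 2 \<in> set p"
      thus False using p(2) by fastforce
    next
      assume a: "v = 3 * l + 2 \<and> 3 * l + 1 \<in> set p"
      hence "v mod 3 = 2" "v - 1 = 3 * l + 1" by presburger+
      thus False using r a by auto
    qed
  qed
  moreover have "count_list (v # p) x = 1" if "x \<in> set (v # p)" "\<not> 3 dvd x" for x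
  proof (cases "x = v")
    case True
    have "v mod 3 = 1 \<or> v mod 3 = 2" using that True by presburger
    hence "v \<notin> set p" using r by auto
    thus ?thesis using True by simp
  next
    case False
    thus ?thesis using that r by (auto simp: parts_le_def strict3_def)
  qed
  ultimately show "v # p \<in> parts_le strict3 v"
    using r by (auto simp: parts_le_def strict3_def partitions_def)
qed

text \<open>In a weakly decreasing list the value \<open>Suc n\<close>, if it occurs, is the head;
  any other head lowers the bound to \<open>n\<close>.\<close>

lemma parts_le_Suc:
  assumes "A \<subseteq> partitions"
  shows "parts_le A (Suc n) =
    parts_le A n \<union> (#) (Suc n) ` {p. Suc n # p \<in> parts_le A (Suc n)}"
proof (intro equalityI subsetI)
  fix q assume q: "q \<in> parts_le A (Suc n)"
  show "q \<in> parts_le A n \<union> (#) (Suc n) ` {p. Suc n # p \<in> parts_le A (Suc n)}"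
  proof (cases "q \<noteq> [] \<and> hd q = Suc n")
    case True
    hence "q = Suc n # tl q" by (cases q) auto
    thus ?thesis using q by (metis UnI2 imageI mem_Collect_eq)
  next
    case False
    have "sorted_wrt (\<ge>) q" using q assms by (auto simp: parts_le_def partitions_def)
    hence "\<forall>x\<in>set q. x \<le> n" using False q by (cases q) (fastforce simp: parts_le_def)+
    thus ?thesis using q by (auto simp: parts_le_def)
  qed
qed (auto simp: parts_le_def le_SucI)

lemma strict3_partitions: "strict3 \<subseteq> partitions"
  by (auto simp: strict3_def)

lemma parts_le_dstrict3: "parts_le dstrict3 n = {p \<in> parts_le strict3 n. distinct p}"
  by (auto simp: parts_le_def dstrict3_def)

lemma parts_le_notin: "p \<in> parts_le A n \<Longrightarrow> n < v \<Longrightarrow> v \<notin> set p"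
  by (auto simp: parts_le_def)

lemma parts_le_pred:
  "p \<in> parts_le A (Suc n) \<and> Suc n \<notin> set p \<longleftrightarrow> p \<in> parts_le A n"
  by (auto simp: parts_le_def le_Suc_eq)

lemma parts_le_pred2:
  "p \<in> parts_le A (Suc (Suc n)) \<and> Suc (Suc n) \<notin> set p \<and> Suc n \<notin> set p \<longleftrightarrow> p \<in> parts_le A n"
  by (metis parts_le_pred)

lemma parts_le_0: "parts_le strict3 0 = {[]}" "parts_le dstrict3 0 = {[]}"
proof -
  have "p = []" if "\<forall>x\<in>set p. 0 < x" "\<forall>x\<in>set p. x \<le> (0::nat)" for p
    using that by (cases p) auto
  thus "parts_le strict3 0 = {[]}" "parts_le dstrict3 0 = {[]}"
    by (auto simp: parts_le_def strict3_def dstrict3_def partitions_def)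
qed

lemma parts_le_strict3_1:
  "parts_le strict3 (3 * N + 1) = parts_le strict3 (3 * N) \<union> (#) (3 * N + 1) ` parts_le strict3 (3 * N)"
proof -
  have "{p. Suc (3 * N) # p \<in> parts_le strict3 (Suc (3 * N))} = parts_le strict3 (3 * N)"
    unfolding parts_le_strict3_Cons using parts_le_pred[of _ strict3 "3 * N"] by auto
  thus ?thesis using parts_le_Suc[OF strict3_partitions, of "3 * N"] by simp
qed

text \<open>A part 3N+2 forbids both itself and 3N+1 in the tail, so the bound drops by two. Hence
  3N+1 and 3N+2 share the same set of tails, and their rows combine to the weight x = a +
  ab.\<close>

lemma parts_le_strict3_2:
  "parts_le strict3 (3 * N + 2) =
     parts_le strict3 (3 * N + 1) \<union> (#) (3 * N + 2) ` parts_le strict3 (3 * N)"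
proof -
  have m: "Suc (Suc (3 * N)) mod 3 = 2" by presburger
  have "{p. Suc (Suc (3 * N)) # p \<in> parts_le strict3 (Suc (Suc (3 * N)))} = parts_le strict3 (3 * N)"
    unfolding parts_le_strict3_Cons m using parts_le_pred2[of _ strict3 "3 * N"] by auto
  thus ?thesis using parts_le_Suc[OF strict3_partitions, of "Suc (3 * N)"] by simp
qed

text \<open>Multiples of 3 may repeat, so the tail ranges over the set being described: this is a
  fixed-point equation and not a reduction.\<close>

lemma parts_le_strict3_3:
  "parts_le strict3 (3 * N + 3) =
     parts_le strict3 (3 * N + 2) \<union> (#) (3 * N + 3) ` parts_le strict3 (3 * N + 3)"
proof -
  have m: "Suc (3 * N + 2) mod 3 = 0" by presburger
  have "{p. Suc (3 * N + 2) # p \<in> parts_le strict3 (Suc (3 * N + 2))} = parts_le strict3 (Suc (3 * N + 2))"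
    unfolding parts_le_strict3_Cons m by auto
  thus ?thesis using parts_le_Suc[OF strict3_partitions, of "3 * N + 2"]
    by (simp add: numeral_3_eq_3)
qed

section \<open>The same decompositions for distinct parts\<close>

lemma parts_le_dstrict3_1:
  "parts_le dstrict3 (3 * N + 1) = parts_le dstrict3 (3 * N) \<union> (#) (3 * N + 1) ` parts_le dstrict3 (3 * N)"
  unfolding parts_le_dstrict3 parts_le_strict3_1
  using parts_le_notin[of _ strict3 "3 * N" "3 * N + 1"] by auto

lemma parts_le_dstrict3_2:
  "parts_le dstrict3 (3 * N + 2) =
     parts_le dstrict3 (3 * N + 1) \<union> (#) (3 * N + 2) ` parts_le dstrict3 (3 * N)"
  unfolding parts_le_dstrict3 parts_le_strict3_2
  using parts_le_notin[of _ strict3 "3 * N" "3 * N + 2"] by auto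

lemma parts_le_dstrict3_3:
  "parts_le dstrict3 (3 * N + 3) =
     parts_le dstrict3 (3 * N + 2) \<union> (#) (3 * N + 3) ` parts_le dstrict3 (3 * N + 2)"
proof -
  have "{p \<in> parts_le strict3 (3 * N + 3). distinct p \<and> 3 * N + 3 \<notin> set p} = parts_le dstrict3 (3 * N + 2)"
    using parts_le_pred[of _ strict3 "3 * N + 2"] unfolding parts_le_dstrict3
    by (auto simp: numeral_3_eq_3)
  moreover have "parts_le dstrict3 (3 * N + 3) = parts_le dstrict3 (3 * N + 2) \<union>
     (#) (3 * N + 3) ` {p \<in> parts_le strict3 (3 * N + 3). distinct p \<and> 3 * N + 3 \<notin> set p}"
    \<comment> \<open>A single \<open>subst\<close>, because the left side of the equation recurs on
      its right.\<close>
    unfolding parts_le_dstrict3 by (subst parts_le_strict3_3) auto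
  ultimately show ?thesis by simp
qed

lemma finite_parts_le_dstrict3: "finite (parts_le dstrict3 n)"
proof (rule finite_subset)
  show "parts_le dstrict3 n \<subseteq> {p. set p \<subseteq> {..n} \<and> distinct p}"
    by (auto simp: parts_le_def dstrict3_def)
qed (rule finite_subset_distinct, simp)

section \<open>Weights\<close>

lemma cell_label_0: "cell_label a b c d e f 0 j = [a, b, c] ! (j mod 3)"
  by (simp add: cell_label_def)

text \<open>Deleting the top row flips the parity of every row index; this is the origin of the
  exchange of (a,b,c) with (d,e,f).\<close>

lemma cell_label_Suc: "cell_label a b c d e f (Suc i) j = cell_label d e f a b c i j"
  by (simp add: cell_label_def)

lemma weight3_Nil [simp]: "weight3 a b c d e f [] = 1"
  by (simp add: weight3_def)

lemma weight3_Cons: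
  "weight3 a b c d e f (v # p) = (\<Prod>j<v. [a, b, c] ! (j mod 3)) * weight3 d e f a b c p"
  by (simp add: weight3_def prod.lessThan_Suc_shift cell_label_0 cell_label_Suc del: prod.lessThan_Suc)

lemma row_weight:
  fixes a b c :: complex
  shows "(\<Prod>j<3 * N. [a, b, c] ! (j mod 3)) = (a * b * c) ^ N"
    "(\<Prod>j<3 * N + 1. [a, b, c] ! (j mod 3)) = a * (a * b * c) ^ N"
    "(\<Prod>j<3 * N + 2. [a, b, c] ! (j mod 3)) = a * b * (a * b * c) ^ N"
proof -
  have m: "Suc (3 * n) mod 3 = Suc 0" "Suc (Suc (3 * n)) mod 3 = 2" for n :: nat by presburger+
  show *: "(\<Prod>j<3 * N. [a, b, c] ! (j mod 3)) = (a * b * c) ^ N"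
  proof (induction N)
    case (Suc N)
    have "3 * Suc N = Suc (Suc (Suc (3 * N)))" by simp
    hence "(\<Prod>j<3 * Suc N. [a, b, c] ! (j mod 3)) = (\<Prod>j<3 * N. [a, b, c] ! (j mod 3)) * a * b * c"
      by (simp add: m del: mult_Suc_right)
    thus ?case unfolding Suc by (simp add: mult_ac del: mult_Suc_right)
  qed simp
  show "(\<Prod>j<3 * N + 1. [a, b, c] ! (j mod 3)) = a * (a * b * c) ^ N"
    using * by simp
  show "(\<Prod>j<3 * N + 2. [a, b, c] ! (j mod 3)) = a * b * (a * b * c) ^ N"
    using * by (simp add: m)
qed

lemma weight3_Cons_3:
  "weight3 a b c d e f ((3 * N + 3) # p) = (a * b * c) ^ Suc N * weight3 d e f a b c p"
  using row_weight(1)[where N = "Suc N"] by (simp add: weight3_Cons add.commute del: power_Suc)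

section \<open>Summability\<close>

text \<open>A bound s for finite sums over \<open>Q\<close> reproduces itself as M + r s, where M is
  the sum over \<open>B\<close>; the fixed point is M / (1 - r). Since \<open>h\<close> increases
  \<open>len\<close>, this can be run as an induction on a bound for \<open>len\<close>.\<close>

lemma summable_on_contraction:
  fixes w :: "'a \<Rightarrow> real" and len :: "'a \<Rightarrow> nat"
  assumes nonneg: "\<And>p. w p \<ge> 0" and r: "0 \<le> r" "r < 1" and inj: "inj h"
    and wh: "\<And>p. w (h p) = r * w p" and len: "\<And>p. len p < len (h p)"
    and Q: "Q \<subseteq> B \<union> h ` Q" and B: "w summable_on B"
  shows "w summable_on Q"
proof -
  define M where "M = infsum w B"
  have M: "sum w F \<le> M" if "finite F" "F \<subseteq> B" for F
    unfolding M_def using that B nonneg by (intro finite_sum_le_infsum) auto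
  have M0: "M \<ge> 0" using M[of "{}"] by simp
  have *: "sum w F \<le> M / (1 - r)" if "finite F" "F \<subseteq> Q" "\<forall>p\<in>F. len p < L" for F L
    using that
  proof (induction L arbitrary: F)
    case 0
    hence "F = {}" by auto
    thus ?case using M0 r by simp
  next
    case (Suc L)
    \<comment> \<open>The preimage of \<open>F\<close> under \<open>h\<close> is finite by
      injectivity, and its elements have smaller \<open>len\<close>, so the induction hypothesis
      applies.\<close>
    define F' where "F' = {p \<in> Q. h p \<in> F}"
    have fin: "finite F'"
      using finite_vimageI[OF Suc.prems(1) inj] by (rule finite_subset[rotated]) (auto simp: F'_def)
    have sub: "F - B \<subseteq> h ` F'" using Suc.prems(2) Q by (fastforce simp: F'_def)
    have "sum w F = sum w (F \<inter> B) + sum w (F - B)"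
      using Suc.prems(1) by (metis sum.Int_Diff)
    also have "\<dots> \<le> M + sum w (h ` F')"
      using Suc.prems(1) fin sub nonneg by (intro add_mono M sum_mono2) auto
    also have "sum w (h ` F') = r * sum w F'"
      using inj by (subst sum.reindex) (auto simp: wh sum_distrib_left intro: inj_on_subset)
    also have "\<dots> \<le> r * (M / (1 - r))"
      using fin Suc.prems(3) len r
      by (intro mult_left_mono Suc.IH) (fastforce simp: F'_def less_Suc_eq_le intro: less_le_trans)+
    also have "M + r * (M / (1 - r)) = M / (1 - r)"
      using r by (simp add: field_simps)
    finally show ?case by simp
  qed
  show ?thesis
  proof (rule nonneg_bdd_above_summable_on)
    show "bdd_above (sum w ` {F. F \<subseteq> Q \<and> finite F})"
    proof (rule bdd_aboveI2)
      fix F assume F: "F \<in> {F. F \<subseteq> Q \<and> finite F}"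
      show "sum w F \<le> M / (1 - r)"
        \<comment> \<open>The sum of all lengths is a convenient bound for each of them.\<close>
        by (rule *[of F "Suc (\<Sum>p\<in>F. len p)"])
           (use F in \<open>auto simp: less_Suc_eq_le intro!: member_le_sum\<close>)
    qed
  qed (rule nonneg)
qed

lemma summable_on_Cons:
  assumes "(\<lambda>p. norm (weight3 d e f a b c p)) summable_on B"
  shows "(\<lambda>p. norm (weight3 a b c d e f p)) summable_on (#) v ` B"
  using assms
  by (subst summable_on_reindex) (auto simp: o_def weight3_Cons norm_mult intro!: summable_on_cmult_right)

text \<open>The first hypothesis ranges over all labels because tails carry the exchanged ones; the
  exchange preserves the product R.\<close>

lemma summable_strict3_12:
  assumes "\<And>a b c d e f. norm (a * b * c * d * e * f) < 1 \<Longrightarrow>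
    (\<lambda>p. norm (weight3 a b c d e f p)) summable_on parts_le strict3 (3 * N)"
    and "norm (a * b * c * d * e * f) < 1"
  shows "(\<lambda>p. norm (weight3 a b c d e f p)) summable_on parts_le strict3 (3 * N + 1)"
    and "(\<lambda>p. norm (weight3 a b c d e f p)) summable_on parts_le strict3 (3 * N + 2)"
proof -
  have "norm (d * e * f * a * b * c) < 1" using assms(2) by (simp add: mult_ac)
  hence C: "(\<lambda>p. norm (weight3 a b c d e f p)) summable_on (#) v ` parts_le strict3 (3 * N)" for v
    by (intro summable_on_Cons assms(1))
  show 1: "(\<lambda>p. norm (weight3 a b c d e f p)) summable_on parts_le strict3 (3 * N + 1)"
    unfolding parts_le_strict3_1 by (intro summable_on_union C assms)
  show "(\<lambda>p. norm (weight3 a b c d e f p)) summable_on parts_le strict3 (3 * N + 2)"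
    unfolding parts_le_strict3_2 by (intro summable_on_union C 1)
qed

lemma summable_strict3_0:
  assumes "norm (a * b * c * d * e * f) < 1"
  shows "(\<lambda>p. norm (weight3 a b c d e f p)) summable_on parts_le strict3 (3 * N)"
  using assms
proof (induction N arbitrary: a b c d e f)
  case 0
  show ?case by (simp add: parts_le_0)
next
  case (Suc N)
  let ?P = "parts_le strict3 (3 * N + 2)" and ?Q = "parts_le strict3 (3 * N + 3)" and ?v = "3 * N + 3"
  have r': "norm (d * e * f * a * b * c) < 1" using Suc.prems by (simp add: mult_ac)
  have "(\<lambda>p. norm (weight3 a b c d e f p)) summable_on ?Q"
  proof (rule summable_on_contraction)
    show "norm (a * b * c * d * e * f) ^ Suc N < 1"
      using Suc.prems by (metis norm_ge_zero power_less_one_iff zero_less_Suc)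
    \<comment> \<open>Two rows are added at once: this restores the labels and scales the weight by
      R^(N+1). One row would scale it by (abc)^(N+1), whose norm may exceed 1.\<close>
    show "inj (\<lambda>p. ?v # ?v # p)" by (simp add: inj_def)
    show "norm (weight3 a b c d e f (?v # ?v # p)) =
        norm (a * b * c * d * e * f) ^ Suc N * norm (weight3 a b c d e f p)" for p
    proof -
      have "weight3 a b c d e f (?v # ?v # p) = ((a * b * c) * (d * e * f)) ^ Suc N * weight3 a b c d e f p"
        by (simp only: weight3_Cons_3 mult.assoc power_mult_distrib)
      thus ?thesis by (simp only: norm_mult norm_power mult.assoc)
    qed
    show "length p < length (?v # ?v # p)" for p by simp
    \<comment> \<open>Using the fixed-point equation twice separates the partitions with no, one, or
      at least two parts 3N+3.\<close>
    show "?Q \<subseteq> (?P \<union> (#) ?v ` ?P) \<union> (\<lambda>p. ?v # ?v # p) ` ?Q"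
      using parts_le_strict3_3[of N] by blast
    have "(\<lambda>p. norm (weight3 d e f a b c p)) summable_on ?P"
      by (rule summable_strict3_12(2)[OF Suc.IH r'])
    moreover have "(\<lambda>p. norm (weight3 a b c d e f p)) summable_on ?P"
      by (rule summable_strict3_12(2)[OF Suc.IH Suc.prems])
    ultimately show "(\<lambda>p. norm (weight3 a b c d e f p)) summable_on (?P \<union> (#) ?v ` ?P)"
      by (intro summable_on_union summable_on_Cons)
  qed simp_all
  thus ?case by (simp add: add.commute)
qed

lemma summable_strict3:
  assumes "norm (a * b * c * d * e * f) < 1"
  shows "(\<lambda>p. norm (weight3 a b c d e f p)) summable_on parts_le strict3 (3 * N)"
    and "(\<lambda>p. norm (weight3 a b c d e f p)) summable_on parts_le strict3 (3 * N + 1)"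
    and "(\<lambda>p. norm (weight3 a b c d e f p)) summable_on parts_le strict3 (3 * N + 2)"
  by (rule summable_strict3_0[OF assms],
      rule summable_strict3_12(1)[OF _ assms], erule summable_strict3_0,
      rule summable_strict3_12(2)[OF _ assms], erule summable_strict3_0)

section \<open>Recurrences\<close>

text \<open>The common form of all recurrences: the union is disjoint because \<open>v\<close>
  occurs in no member of \<open>A\<close>, and the product over \<open>j\<close> is the weight of
  the new top row.\<close>

lemma infsum_weight3_Un_Cons:
  assumes "(\<lambda>p. norm (weight3 a b c d e f p)) summable_on A"
    and "(\<lambda>p. norm (weight3 d e f a b c p)) summable_on B"
    and "\<forall>p\<in>A. v \<notin> set p"
  shows "infsum (weight3 a b c d e f) (A \<union> (#) v ` B) =
    infsum (weight3 a b c d e f) A + (\<Prod>j<v. [a, b, c] ! (j mod 3)) * infsum (weight3 d e f a b c) B"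
proof -
  have B: "weight3 d e f a b c summable_on B" by (rule abs_summable_summable[OF assms(2)])
  have "infsum (weight3 a b c d e f) (A \<union> (#) v ` B) =
      infsum (weight3 a b c d e f) A + infsum (weight3 a b c d e f) ((#) v ` B)"
    by (rule infsum_Un_disjoint[OF abs_summable_summable[OF assms(1)]
        abs_summable_summable[OF summable_on_Cons[OF assms(2)]]]) (use assms(3) in auto)
  also have "infsum (weight3 a b c d e f) ((#) v ` B) =
      (\<Prod>j<v. [a, b, c] ! (j mod 3)) * infsum (weight3 d e f a b c) B"
    by (simp add: infsum_reindex o_def weight3_Cons infsum_cmult_right[OF B])
  finally show ?thesis .
qed

lemma DS3_rec:
  shows "DS3 0 a b c d e f = 1"
    and "DS3 (3 * N + 1) a b c d e f = DS3 (3 * N) a b c d e f + a * (a * b * c) ^ N * DS3 (3 * N) d e f a b c"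
    and "DS3 (3 * N + 2) a b c d e f = DS3 (3 * N + 1) a b c d e f + a * b * (a * b * c) ^ N * DS3 (3 * N) d e f a b c"
    and "DS3 (3 * Suc N) a b c d e f = DS3 (3 * N + 2) a b c d e f + (a * b * c) ^ Suc N * DS3 (3 * N + 2) d e f a b c"
proof -
  note I = infsum_weight3_Un_Cons[OF summable_on_finite[OF finite_parts_le_dstrict3]
    summable_on_finite[OF finite_parts_le_dstrict3]]
  show "DS3 0 a b c d e f = 1" by (simp add: DS3_def parts_le_0)
  show "DS3 (3 * N + 1) a b c d e f = DS3 (3 * N) a b c d e f + a * (a * b * c) ^ N * DS3 (3 * N) d e f a b c"
    unfolding DS3_def parts_le_dstrict3_1 row_weight(2)[symmetric]
    by (rule I) (auto simp: parts_le_def)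
  show "DS3 (3 * N + 2) a b c d e f = DS3 (3 * N + 1) a b c d e f + a * b * (a * b * c) ^ N * DS3 (3 * N) d e f a b c"
    unfolding DS3_def parts_le_dstrict3_2 row_weight(3)[symmetric]
    by (rule I) (auto simp: parts_le_def)
  have "3 * Suc N = 3 * N + 3" by simp
  show "DS3 (3 * Suc N) a b c d e f = DS3 (3 * N + 2) a b c d e f + (a * b * c) ^ Suc N * DS3 (3 * N + 2) d e f a b c"
    unfolding DS3_def row_weight(1)[symmetric] \<open>3 * Suc N = 3 * N + 3\<close> parts_le_dstrict3_3
    by (intro I) (auto simp: parts_le_def)
qed

lemma S3_rec:
  assumes "norm (a * b * c * d * e * f) < 1"
  shows "S3 0 a b c d e f = 1"
    and "S3 (3 * N + 1) a b c d e f = S3 (3 * N) a b c d e f + a * (a * b * c) ^ N * S3 (3 * N) d e f a b c"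
    and "S3 (3 * N + 2) a b c d e f = S3 (3 * N + 1) a b c d e f + a * b * (a * b * c) ^ N * S3 (3 * N) d e f a b c"
    and "S3 (3 * Suc N) a b c d e f = S3 (3 * N + 2) a b c d e f + (a * b * c) ^ Suc N * S3 (3 * Suc N) d e f a b c"
proof -
  have r': "norm (d * e * f * a * b * c) < 1" using assms by (simp add: mult_ac)
  show "S3 0 a b c d e f = 1" by (simp add: S3_def parts_le_0)
  show "S3 (3 * N + 1) a b c d e f = S3 (3 * N) a b c d e f + a * (a * b * c) ^ N * S3 (3 * N) d e f a b c"
    unfolding S3_def parts_le_strict3_1 row_weight(2)[symmetric]
    by (intro infsum_weight3_Un_Cons summable_strict3 assms r') (auto simp: parts_le_def)
  show "S3 (3 * N + 2) a b c d e f = S3 (3 * N + 1) a b c d e f + a * b * (a * b * c) ^ N * S3 (3 * N) d e f a b c"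
    unfolding S3_def parts_le_strict3_2 row_weight(3)[symmetric]
    by (intro infsum_weight3_Un_Cons summable_strict3 assms r') (auto simp: parts_le_def)
  show "S3 (3 * Suc N) a b c d e f = S3 (3 * N + 2) a b c d e f + (a * b * c) ^ Suc N * S3 (3 * Suc N) d e f a b c"
  proof -
    have N: "3 * Suc N = 3 * N + 3" by simp
    have "infsum (weight3 a b c d e f) (parts_le strict3 (3 * N + 3)) =
        infsum (weight3 a b c d e f)
          (parts_le strict3 (3 * N + 2) \<union> (#) (3 * N + 3) ` parts_le strict3 (3 * N + 3))"
      using parts_le_strict3_3 by simp
    also have "\<dots> = S3 (3 * N + 2) a b c d e f + (a * b * c) ^ Suc N * S3 (3 * Suc N) d e f a b c"
      unfolding S3_def row_weight(1)[symmetric] N[symmetric]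
      by (intro infsum_weight3_Un_Cons summable_strict3 assms r') (auto simp: parts_le_def)
    finally show ?thesis by (simp only: S3_def N)
  qed
qed

text \<open>The last recurrence of \<open>S3_rec\<close>, inserted into its own exchanged version,
  eliminates the exchanged value at 3(N+1) and leaves the factor (abc)^(N+1) (def)^(N+1) =
  R^(N+1).\<close>

lemma S3_Suc:
  assumes "norm (a * b * c * d * e * f) < 1"
  shows "(1 - (a * b * c * d * e * f) ^ Suc N) * S3 (3 * Suc N) a b c d e f =
    S3 (3 * N + 2) a b c d e f + (a * b * c) ^ Suc N * S3 (3 * N + 2) d e f a b c"
proof -
  have r': "norm (d * e * f * a * b * c) < 1" using assms by (simp add: mult_ac)
  have p: "(a * b * c * d * e * f) ^ Suc N = (a * b * c) ^ Suc N * (d * e * f) ^ Suc N"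
    by (simp only: power_mult_distrib[symmetric] mult_ac)
  show ?thesis
    using S3_rec(4)[OF assms, of N]
    unfolding p S3_rec(4)[OF r', of N] by (simp add: algebra_simps del: power_Suc)
qed

section \<open>The closed form\<close>

lemma qpoch_0: "qpoch x q 0 = 1"
  by (simp add: qpoch_def)

lemma qpoch_Suc: "qpoch x q (Suc n) = qpoch x q n * (1 - x * q ^ n)"
  by (simp add: qpoch_def)

lemma qpoch_nonzero:
  assumes "norm q < 1"
  shows "qpoch q q n \<noteq> 0"
proof -
  have "q * q ^ n \<noteq> 1" for n
  proof
    assume "q * q ^ n = 1"
    hence "norm q ^ Suc n = 1" by (metis norm_one norm_power power_Suc)
    moreover have "norm q ^ Suc n < 1"
      using assms by (metis norm_ge_zero power_less_one_iff zero_less_Suc)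
    ultimately show False by simp
  qed
  thus ?thesis by (induction n) (auto simp: qpoch_0 qpoch_Suc)
qed

text \<open>By Euler's identities these are \<open>(-xT;q)\<close> and \<open>1 / (xT;q)\<close>, as infinite products.\<close>

definition euler_num :: "complex \<Rightarrow> complex \<Rightarrow> complex fps" where
  "euler_num q x = Abs_fps (\<lambda>n. q ^ (n choose 2) * x ^ n / qpoch q q n)"

definition euler_den :: "complex \<Rightarrow> complex \<Rightarrow> complex fps" where
  "euler_den q x = Abs_fps (\<lambda>n. x ^ n / qpoch q q n)"

lemma euler_num_scale: "euler_num q x oo (fps_const s * fps_X) = euler_num q (s * x)"
  by (rule fps_ext) (simp add: euler_num_def fps_compose_linear power_mult_distrib)

lemma euler_den_scale: "euler_den q x oo (fps_const s * fps_X) = euler_den q (s * x)"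
  by (rule fps_ext) (simp add: euler_den_def fps_compose_linear power_mult_distrib)

text \<open>This splits off the first factor of the infinite product (-xT;q). On coefficients it
  rests on binom(m+1,2) = m + binom(m,2).\<close>

lemma euler_num_eq:
  assumes "norm q < 1"
  shows "euler_num q x = (1 + fps_const x * fps_X) * euler_num q (q * x)"
proof (rule fps_ext)
  fix n
  show "euler_num q x $ n = ((1 + fps_const x * fps_X) * euler_num q (q * x)) $ n"
  proof (cases n)
    case 0
    thus ?thesis by (simp add: euler_num_def)
  next
    case (Suc m)
    have nz: "qpoch q q m \<noteq> 0" "1 - q * q ^ m \<noteq> 0"
      using qpoch_nonzero[OF assms, of "Suc m"] by (auto simp: qpoch_Suc)
    have "Suc m choose 2 = m + (m choose 2)" by (simp add: numeral_2_eq_2)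
    thus ?thesis using nz Suc
      by (simp add: euler_num_def distrib_right mult.assoc qpoch_Suc power_add power_mult_distrib
          field_simps)
  qed
qed

text \<open>This cancels the first factor 1 - xT of the infinite product (xT;q) in the
  denominator.\<close>

lemma euler_den_eq:
  assumes "norm q < 1"
  shows "euler_den q (q * x) = (1 - fps_const x * fps_X) * euler_den q x"
proof (rule fps_ext)
  fix n
  show "euler_den q (q * x) $ n = ((1 - fps_const x * fps_X) * euler_den q x) $ n"
  proof (cases n)
    case 0
    thus ?thesis by (simp add: euler_den_def)
  next
    case (Suc m)
    have nz: "qpoch q q m \<noteq> 0" "1 - q * q ^ m \<noteq> 0"
      using qpoch_nonzero[OF assms, of "Suc m"] by (auto simp: qpoch_Suc)
    thus ?thesis using Suc
      by (simp add: euler_den_def left_diff_distrib mult.assoc qpoch_Suc power_mult_distrib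
          field_simps)
  qed
qed

section \<open>Quadruple sums as coefficients of a product of four series\<close>

lemma sum_quads:
  "(\<Sum>(i, j, k, l)\<in>quads N. f i j k l) =
     (\<Sum>i=0..N. \<Sum>j=0..N-i. \<Sum>k=0..N-i-j. f i j k (N-i-j-k))"
  for f :: "nat \<Rightarrow> nat \<Rightarrow> nat \<Rightarrow> nat \<Rightarrow> complex"
proof -
  have "(\<Sum>i=0..N. \<Sum>j=0..N-i. \<Sum>k=0..N-i-j. f i j k (N-i-j-k)) =
      (\<Sum>(i, j, k)\<in>(SIGMA i:{0..N}. SIGMA j:{0..N-i}. {0..N-i-j}). f i j k (N-i-j-k))"
    by (simp add: sum.Sigma)
  also have "\<dots> = (\<Sum>(i, j, k, l)\<in>quads N. f i j k l)"
    by (rule sum.reindex_bij_witness[where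
          i = "\<lambda>(i, j, k, l). (i, j, k)" and j = "\<lambda>(i, j, k). (i, j, k, N - i - j - k)"])
       (auto simp: quads_def)
  finally show ?thesis ..
qed

text \<open>The nested ranges in \<open>sum_quads\<close> are those of three successive Cauchy
  products, the fourth index being determined by the others.\<close>

lemma sum_quads_fps:
  "(\<Sum>(t1, t2, t3, t4)\<in>quads N. A $ t1 * B $ t2 * C $ t3 * D $ t4) = (A * (B * (C * D))) $ N"
  for A B C D :: "complex fps"
  unfolding sum_quads by (simp add: fps_mult_nth sum_distrib_left mult.assoc)

text \<open>As infinite products, (-xT;q) (-uT;q) / ((zT;q) (yT;q)). The series G has
  \<open>y = 1\<close>; the parameter stays free because replacing T by sT turns 1 into s.\<close>

definition gen_fps :: "complex \<Rightarrow> complex \<Rightarrow> complex \<Rightarrow> complex \<Rightarrow> complex \<Rightarrow> complex fps" where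
  "gen_fps q x u z y = euler_num q x * (euler_num q u * (euler_den q z * euler_den q y))"

lemma gen_fps_scale:
  "gen_fps q x u z y oo (fps_const s * fps_X) = gen_fps q (s * x) (s * u) (s * z) (s * y)"
  by (simp add: gen_fps_def fps_compose_mult_distrib euler_num_scale euler_den_scale)

text \<open>Replacing T by sT absorbs powers such as the z^N in front of the exchanged sum.\<close>

lemma gen_fps_nth_scale:
  "s ^ n * gen_fps q x u z y $ n = gen_fps q (s * x) (s * u) (s * z) (s * y) $ n"
  by (simp add: gen_fps_scale[symmetric] fps_compose_linear)

context
  fixes q x u z :: complex
  assumes q: "norm q < 1"
begin

text \<open>Every term is a multiple of (-qxT;q) (-quT;q) / ((zT;q) (T;q)). What remains is
  (1+xT)(1+uT) - (1-zT)(1-T) = T ((1+xT)(1+uT) + u(1-zT)(1-T) + (x+z)(1+uT)(1-T)).\<close>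

lemma gen_fps_rec:
  "gen_fps q x u z 1 - gen_fps q (q * x) (q * u) (q * z) q = fps_X *
    (gen_fps q x u z 1 + fps_const u * gen_fps q (q * x) (q * u) (q * z) q
      + fps_const (x + z) * gen_fps q u (q * x) q z)"
  unfolding gen_fps_def euler_num_eq[OF q, of x] euler_num_eq[OF q, of u]
    euler_den_eq[OF q, of z] euler_den_eq[OF q, of 1, simplified]
  \<comment> \<open>Constants are split over sums so that \<open>algebra\<close> sees a polynomial
    identity in common atoms.\<close>
  by (simp add: fps_const_add[symmetric] del: fps_const_add) algebra

text \<open>The coefficient of T^(n+1) in \<open>gen_fps_rec\<close>; it has the shape of the
  recurrence for S(3N), with \<open>q\<close> as R.\<close>

lemma gen_fps_nth_Suc:
  "(1 - q ^ Suc n) * gen_fps q x u z 1 $ Suc n =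
    (1 + u * q ^ n) * gen_fps q x u z 1 $ n + (x + z) * gen_fps q u (q * x) q z $ n"
  using arg_cong[OF gen_fps_rec, of "\<lambda>h. h $ Suc n"]
    gen_fps_nth_scale[of q "Suc n" q x u z 1] gen_fps_nth_scale[of q n q x u z 1]
  by (simp add: algebra_simps)

text \<open>After division by the common factor this is (1 + xT) + x(1 - T) = 1 + x.\<close>

lemma gen_fps_add:
  "gen_fps q x u z 1 + fps_const x * gen_fps q u (q * x) q z = fps_const (1 + x) * gen_fps q (q * x) u z 1"
  unfolding gen_fps_def euler_num_eq[OF q, of x] euler_den_eq[OF q, of 1, simplified]
  by (simp add: fps_const_add[symmetric] del: fps_const_add) algebra

end

section \<open>Closed forms of S(3N) and S(3N+2)\<close>

lemma S3_closed_form: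
  assumes "norm (a * b * c * d * e * f) < 1"
  shows "S3 (3 * N) a b c d e f =
    gen_fps (a * b * c * d * e * f) (a + a * b) (a * b * c * (d + d * e)) (a * b * c) 1 $ N"
  using assms
\<comment> \<open>The labels are generalized because the step also uses the hypothesis with the two
  triples exchanged.\<close>
proof (induction N arbitrary: a b c d e f)
  case 0
  show ?case
    using S3_rec(1)[OF 0] by (simp add: gen_fps_def euler_num_def euler_den_def qpoch_0 numeral_2_eq_2)
next
  case (Suc N)
  define R where "R = a * b * c * d * e * f"
  define x where "x = a + a * b"
  define y where "y = d + d * e"
  define z where "z = a * b * c"
  define z' where "z' = d * e * f"
  have R: "norm R < 1" using Suc.prems by (simp add: R_def)
  have Rz: "R = z * z'" by (simp add: R_def z_def z'_def mult_ac)
  have r': "norm (d * e * f * a * b * c) < 1" using Suc.prems by (simp add: mult_ac)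
  have S: "S3 (3 * N) a b c d e f = gen_fps R x (z * y) z 1 $ N"
    using Suc.IH[OF Suc.prems] by (simp add: R_def x_def y_def z_def)
  have "d * e * f * a * b * c = R" by (simp add: R_def mult_ac)
  hence "z ^ N * S3 (3 * N) d e f a b c = z ^ N * gen_fps R y (z' * x) z' 1 $ N"
    using Suc.IH[OF r'] by (simp add: x_def y_def z'_def)
  \<comment> \<open>Scaling by \<open>z\<close> turns the parameters y, z'x, z', 1 into zy, Rx, R,
    z, as zz' = R.\<close>
  hence S': "z ^ N * S3 (3 * N) d e f a b c = gen_fps R (z * y) (R * x) R z $ N"
    by (simp add: gen_fps_nth_scale Rz mult_ac)
  have "(1 - R ^ Suc N) * S3 (3 * Suc N) a b c d e f =
      S3 (3 * N) a b c d e f + x * (z ^ N * S3 (3 * N) d e f a b c) +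
      z ^ Suc N * (S3 (3 * N) d e f a b c + y * z' ^ N * S3 (3 * N) a b c d e f)"
    using S3_Suc[OF Suc.prems, of N, folded R_def]
    unfolding S3_rec(2,3)[OF Suc.prems] S3_rec(2,3)[OF r'] z_def[symmetric] z'_def[symmetric]
    by (simp add: x_def y_def algebra_simps)
  also have "\<dots> = (1 + z * y * R ^ N) * S3 (3 * N) a b c d e f + (x + z) * (z ^ N * S3 (3 * N) d e f a b c)"
    by (simp add: Rz power_mult_distrib algebra_simps)
  also have "\<dots> = (1 - R ^ Suc N) * gen_fps R x (z * y) z 1 $ Suc N"
    unfolding S S' by (rule gen_fps_nth_Suc[OF R, symmetric])
  \<comment> \<open>The factor 1 - R^(N+1) cancels: it divides the nonzero (R;R)_(N+1).\<close>
  finally have "S3 (3 * Suc N) a b c d e f = gen_fps R x (z * y) z 1 $ Suc N"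
    using qpoch_nonzero[OF R, of "Suc N"] by (simp add: qpoch_Suc)
  thus ?case by (simp add: R_def x_def y_def z_def)
qed

text \<open>S(3N+2) = S(3N) + x z^N S'(3N), and \<open>gen_fps_add\<close> merges the two series
  into one with x replaced by Rx.\<close>

lemma S3_2_closed_form:
  assumes "norm (a * b * c * d * e * f) < 1"
  shows "S3 (3 * N + 2) a b c d e f = (1 + a + a * b) *
    gen_fps (a * b * c * d * e * f) (a * b * c * d * e * f * (a + a * b)) (a * b * c * (d + d * e)) (a * b * c) 1 $ N"
proof -
  define R where "R = a * b * c * d * e * f"
  define x where "x = a + a * b"
  define y where "y = d + d * e"
  define z where "z = a * b * c"
  have R: "norm R < 1" using assms by (simp add: R_def)
  have r': "norm (d * e * f * a * b * c) < 1" using assms by (simp add: mult_ac)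
  have eq: "d * e * f * a * b * c = R" "z * (d * e * f) = R" by (simp_all add: R_def z_def mult_ac)
  have "z ^ N * S3 (3 * N) d e f a b c = gen_fps R (z * y) (z * (d * e * f) * x) (z * (d * e * f)) z $ N"
    using S3_closed_form[OF r', of N, unfolded eq]
    by (simp add: x_def y_def gen_fps_nth_scale mult.assoc)
  hence S': "z ^ N * S3 (3 * N) d e f a b c = gen_fps R (z * y) (R * x) R z $ N"
    unfolding eq .
  have "S3 (3 * N + 2) a b c d e f = S3 (3 * N) a b c d e f + x * (z ^ N * S3 (3 * N) d e f a b c)"
    unfolding S3_rec(2,3)[OF assms] by (simp add: x_def z_def algebra_simps)
  also have "S3 (3 * N) a b c d e f = gen_fps R x (z * y) z 1 $ N"
    using S3_closed_form[OF assms] by (simp add: R_def x_def y_def z_def)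
  also have "gen_fps R x (z * y) z 1 $ N + x * (z ^ N * S3 (3 * N) d e f a b c) =
      (1 + x) * gen_fps R (R * x) (z * y) z 1 $ N"
    unfolding S' using arg_cong[OF gen_fps_add[OF R], of "\<lambda>h. h $ N"] by simp
  finally show ?thesis by (simp add: R_def x_def y_def z_def add.assoc)
qed

lemma gen_fps_nth:
  "gen_fps q x u z 1 $ N = (\<Sum>(t1, t2, t3, t4)\<in>quads N.
     q ^ ((t1 choose 2) + (t2 choose 2)) * (x ^ t1 * u ^ t2 * z ^ t3 /
       (qpoch q q t1 * qpoch q q t2 * qpoch q q t3 * qpoch q q t4)))"
  unfolding gen_fps_def sum_quads_fps[symmetric]
  by (intro sum.cong) (auto simp: euler_num_def euler_den_def power_add)

text \<open>The recurrence for distinct parts has the right side of \<open>S3_Suc\<close>; the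
  factor 1 - R^(N+1) on the left there is the one that extends (R;R)_N. The exchange of labels fixes
  R, so both values carry the same factor (R;R)_N.\<close>

lemma DS3_eq:
  assumes "norm (a * b * c * d * e * f) < 1"
  shows "DS3 (3 * N) a b c d e f =
    qpoch (a * b * c * d * e * f) (a * b * c * d * e * f) N * S3 (3 * N) a b c d e f"
  using assms
proof (induction N arbitrary: a b c d e f)
  case 0
  show ?case using DS3_rec(1) S3_rec(1)[OF 0] by (simp add: qpoch_0)
next
  case (Suc N)
  define R where "R = a * b * c * d * e * f"
  have r': "norm (d * e * f * a * b * c) < 1" using Suc.prems by (simp add: mult_ac)
  have eq: "d * e * f * a * b * c = R" by (simp add: R_def mult_ac)
  note IH = Suc.IH[OF Suc.prems, folded R_def] Suc.IH[OF r', unfolded eq]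
  have "DS3 (3 * Suc N) a b c d e f =
      qpoch R R N * (S3 (3 * N + 2) a b c d e f + (a * b * c) ^ Suc N * S3 (3 * N + 2) d e f a b c)"
    unfolding DS3_rec(2-4) IH S3_rec(2,3)[OF Suc.prems] S3_rec(2,3)[OF r']
    by (simp add: algebra_simps)
  also have "\<dots> = qpoch R R N * ((1 - R ^ Suc N) * S3 (3 * Suc N) a b c d e f)"
    unfolding S3_Suc[OF Suc.prems, folded R_def] ..
  finally show ?case by (simp add: R_def qpoch_Suc)
qed

theorem theorem3p8:
  fixes N :: nat and a b c d e f R :: complex
  assumes R_def: "R = a * b * c * d * e * f"
    and R_less: "norm R < 1"
  shows "(\<forall>\<mu>\<in>{0, 1, 2}.
            (\<lambda>p. norm (weight3 a b c d e f p)) summable_on parts_le strict3 (3 * N + \<mu>))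
    \<and> S3 (3 * N) a b c d e f =
        (\<Sum>(t1, t2, t3, t4)\<in>quads N.
            R ^ ((t1 choose 2) + (t2 choose 2)) * F_term a b c d e f t1 t2 t3 t4)
    \<and> S3 (3 * N + 2) a b c d e f =
        (1 + a + a * b) *
        (\<Sum>(t1, t2, t3, t4)\<in>quads N.
            R ^ (((t1 + 1) choose 2) + (t2 choose 2)) * F_term a b c d e f t1 t2 t3 t4)
    \<and> S3 (3 * N + 1) a b c d e f =
        S3 (3 * N) a b c d e f + a * (a * b * c) ^ N * S3 (3 * N) d e f a b c
    \<and> (\<forall>\<mu>\<in>{0, 1, 2}. DS3 (3 * N + \<mu>) a b c d e f = qpoch R R N * S3 (3 * N + \<mu>) a b c d e f)"
proof -
  have r: "norm (a * b * c * d * e * f) < 1" using assms by simp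
  have r': "norm (d * e * f * a * b * c) < 1" using r by (simp add: mult_ac)
  have eq: "d * e * f * a * b * c = R" by (simp add: R_def mult_ac)
  \<comment> \<open>Here abcd + abcde is written as u = abc(d + de).\<close>
  have F: "F_term a b c d e f t1 t2 t3 t4 =
      (a + a * b) ^ t1 * (a * b * c * (d + d * e)) ^ t2 * (a * b * c) ^ t3 /
      (qpoch R R t1 * qpoch R R t2 * qpoch R R t3 * qpoch R R t4)" for t1 t2 t3 t4
    by (simp add: F_term_def Let_def R_def distrib_left mult.assoc)
  \<comment> \<open>This turns R^binom(t1,2) (Rx)^t1 into R^binom(t1+1,2) x^t1.\<close>
  have c: "Suc t choose 2 = t + (t choose 2)" for t by (simp add: numeral_2_eq_2)
  have "S3 (3 * N) a b c d e f = (\<Sum>(t1, t2, t3, t4)\<in>quads N.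
      R ^ ((t1 choose 2) + (t2 choose 2)) * F_term a b c d e f t1 t2 t3 t4)"
    unfolding F S3_closed_form[OF r] R_def gen_fps_nth ..
  moreover have "S3 (3 * N + 2) a b c d e f = (1 + a + a * b) * (\<Sum>(t1, t2, t3, t4)\<in>quads N.
      R ^ (((t1 + 1) choose 2) + (t2 choose 2)) * F_term a b c d e f t1 t2 t3 t4)"
    unfolding F S3_2_closed_form[OF r, folded R_def] gen_fps_nth
    by (intro arg_cong[where f = "(*) (1 + a + a * b)"] sum.cong)
       (auto simp: c power_add power_mult_distrib mult_ac)
  moreover have "DS3 (3 * N + \<mu>) a b c d e f = qpoch R R N * S3 (3 * N + \<mu>) a b c d e f"
    if "\<mu> \<in> {0, 1, 2}" for \<mu>
  proof -
    \<comment> \<open>Residues 1 and 2 follow from residue 0, since \<open>DS3\<close> and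
      \<open>S3\<close> obey the same linear recurrences there.\<close>
    note D = DS3_eq[OF r, of N, folded R_def] DS3_eq[OF r', of N, unfolded eq]
    have "DS3 (3 * N + 1) a b c d e f = qpoch R R N * S3 (3 * N + 1) a b c d e f"
      unfolding DS3_rec(2) D S3_rec(2)[OF r] by (simp add: algebra_simps)
    moreover from this
    have "DS3 (3 * N + 2) a b c d e f = qpoch R R N * S3 (3 * N + 2) a b c d e f"
      unfolding DS3_rec(3) D S3_rec(3)[OF r] by (simp add: algebra_simps)
    ultimately show ?thesis using that D by auto
  qed
  ultimately show ?thesis
    using summable_strict3[OF r, of N] S3_rec(2)[OF r, of N] by auto
qed

end
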